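(* Let $(x,y)$ be an optimal solution of the linear program: maximize $\sum_{(i,j)\in E} w_{ij}\sum_{h=1}^k x^h_{ij}$ subject to $\sum_{h=1}^k y^h_{ij}\le1$ for all $(i,j)\in E$; $\sum_{j:(i,j)\in E}\sum_{h=1}^k y^h_{ij}\le t_i$ for all $i\in V$; $y^h\in\mathcal{M}_C(G)$ for all $h\in[k]$; $x^h_{ij}=p_{ij}y^h_{ij}$; and $\sum_{j:(i,j)\in E}\sum_{h=1}^k x^h_{ij}\le 1$ for all $i\in V$. For each $h$ write $y^h=\sum_\ell\lambda^h_\ell\chi(M^h_\ell)$ as a convex combination ($\lambda^h_\ell>0$, $\sum_\ell\lambda^h_\ell=1$) of characteristic vectors of matchings $M^h_\ell$ of size at most $C$. Consider the algorithm that, for each round $h=1,\dots,k$, independently sets $P^h=\emptyset$ with probability $1-1/\alpha$ and $P^h=M^h_\ell$ with probability $\lambda^h_\ell/\alpha$, and then probes all edges of $P^h$ that are safe. With $\alpha=10$ this algorithm is a $20$-approximation for the weighted cardinality constrained multiple-round stochastic matching problem.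
   Context: Weighted cardinality constrained multiple-round stochastic matching: an undirected graph $G=(V,E)$, weights $w_{ij}\ge0$ and probabilities $p_{ij}\in[0,1]$ on edges, positive integer patiences $t_i$ on vertices, and positive integers $k,C$. Each edge is independently present with probability $p_{ij}$, revealed only when probed. A strategy proceeds in at most $k$ rounds, in each round probing a set of edges forming a matching of size at most $C$; a present probed edge is irrevocably added to the matching. An edge $(i,j)$ is safe if it has not been probed before, neither $i$ nor $j$ is matched, and neither has timed out (vertex $i$ has timed out if $t_i$ edges incident to it have been probed); only safe edges may be probed. $\mathcal{M}_C(G)$ denotes the convex hull of characteristic vectors of matchings of $G$ of size at most $C$. The objective is the expected total weight of matched edges; an $\alpha$-approximation achieves at least $1/\alpha$ times the maximum expected value of an adaptive strategy. *)

theory Defs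
  imports "HOL-Probability.Probability" "HOL-Analysis.Finite_Function_Topology"
begin

section \<open>Graphs, matchings and the matching polytope\<close>

definition simple_graph :: "'v set \<Rightarrow> 'v set set \<Rightarrow> bool" where
  "simple_graph V E \<longleftrightarrow> finite V \<and> (\<forall>e\<in>E. e \<subseteq> V \<and> card e = 2)"

definition matchings :: "'v set set \<Rightarrow> nat \<Rightarrow> 'v set set set" where
  "matchings E C = {M. M \<subseteq> E \<and> pairwise disjnt M \<and> card M \<le> C}"

text \<open>Plain functions on edges do not form a \<open>real_vector\<close> instance in the library, whereas
  finitely supported ones do. Hence the convex hull is taken there.\<close>

definition char_vec :: "'e set \<Rightarrow> 'e \<Rightarrow>\<^sub>0 real" where
  "char_vec M = (\<Sum>e\<in>M. Poly_Mapping.single e 1)"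

lemma lookup_char_vec:
  assumes "finite M"
  shows "Poly_Mapping.lookup (char_vec M) e = indicator M e"
  using assms by (simp add: char_vec_def lookup_sum lookup_single when_def indicator_def)

text \<open>Only the coordinates in \<open>E\<close> of a vector \<open>y\<close> are meaningful.\<close>

definition matching_polytope :: "'v set set \<Rightarrow> nat \<Rightarrow> ('v set \<Rightarrow> real) set" where
  "matching_polytope E C =
     {y. \<exists>z \<in> convex hull (char_vec ` matchings E C). \<forall>e\<in>E. y e = Poly_Mapping.lookup z e}"

section \<open>Strategies\<close>

text \<open>A history lists, for each past round, the set of probed edges together with the subset of
  those that turned out to be present.\<close>

type_synonym 'v history = "('v set set \<times> 'v set set) list"

definition probed :: "'v history \<Rightarrow> 'v set set" where
  "probed H = (\<Union>(Q, S)\<in>set H. Q)"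

definition matched :: "'v history \<Rightarrow> 'v set set" where
  "matched H = (\<Union>(Q, S)\<in>set H. S)"

definition timed_out :: "('v \<Rightarrow> nat) \<Rightarrow> 'v history \<Rightarrow> 'v \<Rightarrow> bool" where
  "timed_out t H v \<longleftrightarrow> t v \<le> card {e \<in> probed H. v \<in> e}"

definition safe :: "'v set set \<Rightarrow> ('v \<Rightarrow> nat) \<Rightarrow> 'v history \<Rightarrow> 'v set \<Rightarrow> bool" where
  "safe E t H e \<longleftrightarrow>
     e \<in> E \<and> e \<notin> probed H \<and> (\<forall>v\<in>e. v \<notin> \<Union>(matched H) \<and> \<not> timed_out t H v)"

text \<open>An adaptive, possibly randomized strategy maps the history to the distribution of the set
  of edges probed in the next round. Probing fewer than \<open>k\<close> rounds amounts to probing the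
  empty set from some round on.\<close>

definition strategies ::
    "'v set set \<Rightarrow> ('v \<Rightarrow> nat) \<Rightarrow> nat \<Rightarrow> nat \<Rightarrow> ('v history \<Rightarrow> 'v set set pmf) set" where
  "strategies E t k C =
     {\<sigma>. \<forall>H. length H < k \<longrightarrow>
        (\<forall>Q\<in>set_pmf (\<sigma> H). Q \<in> matchings E C \<and> (\<forall>e\<in>Q. safe E t H e))}"

text \<open>All edges are realized up front; a strategy learns about the set \<open>A\<close> of present edges only
  through the history.\<close>

definition present_edges :: "'e set \<Rightarrow> ('e \<Rightarrow> real) \<Rightarrow> 'e set pmf" where
  "present_edges E p =
     map_pmf (\<lambda>f. {e \<in> E. f e}) (Pi_pmf E False (\<lambda>e. bernoulli_pmf (p e)))"

primrec run :: "('v history \<Rightarrow> 'v set set pmf) \<Rightarrow> 'v set set \<Rightarrow> nat \<Rightarrow> 'v history pmf" where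
  "run \<sigma> A 0 = return_pmf []"
| "run \<sigma> A (Suc n) =
     bind_pmf (run \<sigma> A n) (\<lambda>H. map_pmf (\<lambda>Q. H @ [(Q, Q \<inter> A)]) (\<sigma> H))"

definition expected_weight ::
    "'v set set \<Rightarrow> ('v set \<Rightarrow> real) \<Rightarrow> ('v set \<Rightarrow> real) \<Rightarrow> nat
      \<Rightarrow> ('v history \<Rightarrow> 'v set set pmf) \<Rightarrow> real" where
  "expected_weight E w p k \<sigma> =
     measure_pmf.expectation (bind_pmf (present_edges E p) (\<lambda>A. run \<sigma> A k))
       (\<lambda>H. \<Sum>e\<in>matched H. w e)"

definition opt ::
    "'v set set \<Rightarrow> ('v set \<Rightarrow> real) \<Rightarrow> ('v set \<Rightarrow> real) \<Rightarrow> ('v \<Rightarrow> nat) \<Rightarrow> nat \<Rightarrow> nat \<Rightarrow> real" where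
  "opt E w p t k C = (SUP \<sigma>\<in>strategies E t k C. expected_weight E w p k \<sigma>)"

definition approximation ::
    "real \<Rightarrow> 'v set set \<Rightarrow> ('v set \<Rightarrow> real) \<Rightarrow> ('v set \<Rightarrow> real) \<Rightarrow> ('v \<Rightarrow> nat) \<Rightarrow> nat \<Rightarrow> nat
      \<Rightarrow> ('v history \<Rightarrow> 'v set set pmf) \<Rightarrow> bool" where
  "approximation \<alpha> E w p t k C \<sigma> \<longleftrightarrow>
     \<sigma> \<in> strategies E t k C \<and> expected_weight E w p k \<sigma> \<ge> 1 / \<alpha> * opt E w p t k C"

text \<open>The supremum in \<open>opt\<close> is over a nonempty set that is bounded above.\<close>

lemma run_matched:
  assumes \<sigma>: "\<sigma> \<in> strategies E t k C" and "n \<le> k" and "H \<in> set_pmf (run \<sigma> A n)"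
  shows "length H = n \<and> matched H \<subseteq> E"
  using assms(2,3)
proof (induction n arbitrary: H)
  case 0
  then show ?case by (simp add: matched_def)
next
  case (Suc n)
  from Suc.prems(2) obtain H' Q where H': "H' \<in> set_pmf (run \<sigma> A n)" and Q: "Q \<in> set_pmf (\<sigma> H')"
    and H: "H = H' @ [(Q, Q \<inter> A)]" by auto
  have IH: "length H' = n" "matched H' \<subseteq> E"
    using Suc.IH[OF _ H'] Suc.prems(1) by auto
  then have "length H' < k" using Suc.prems(1) by simp
  with \<sigma> Q have "Q \<in> matchings E C"
    unfolding strategies_def by blast
  then have "Q \<subseteq> E" by (simp add: matchings_def)
  with IH H show ?case by (auto simp: matched_def)
qed

lemma expected_weight_bounded:
  assumes "finite E" and w: "\<And>e. e \<in> E \<Longrightarrow> w e \<ge> 0" and \<sigma>: "\<sigma> \<in> strategies E t k C"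
  shows "expected_weight E w p k \<sigma> \<le> sum w E"
proof -
  let ?D = "bind_pmf (present_edges E p) (\<lambda>A. run \<sigma> A k)"
  have b: "0 \<le> sum w (matched H) \<and> sum w (matched H) \<le> sum w E" if "H \<in> set_pmf ?D" for H
  proof -
    from that obtain A where "H \<in> set_pmf (run \<sigma> A k)" by auto
    then have "matched H \<subseteq> E" using run_matched[OF \<sigma> order_refl] by blast
    then show ?thesis using assms(1) w by (auto intro!: sum_mono2 sum_nonneg)
  qed
  have "integrable (measure_pmf ?D) (\<lambda>H. sum w (matched H))"
    using b by (intro measure_pmf.integrable_const_bound[where B = "sum w E"])
      (auto simp: AE_measure_pmf_iff)
  then have "expected_weight E w p k \<sigma> \<le> measure_pmf.expectation ?D (\<lambda>_. sum w E)"
    unfolding expected_weight_def using b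
    by (intro integral_mono_AE) (auto simp: AE_measure_pmf_iff)
  then show ?thesis by simp
qed

lemma strategies_nonempty: "(\<lambda>H. return_pmf {}) \<in> strategies E t k C"
  by (simp add: strategies_def matchings_def)

lemma expected_weight_le_opt:
  assumes "finite E" and "\<And>e. e \<in> E \<Longrightarrow> w e \<ge> 0" and "\<sigma> \<in> strategies E t k C"
  shows "expected_weight E w p k \<sigma> \<le> opt E w p t k C"
  unfolding opt_def
proof (rule cSUP_upper[OF assms(3)])
  show "bdd_above (expected_weight E w p k ` strategies E t k C)"
    by (rule bdd_aboveI2[where M = "sum w E"]) (rule expected_weight_bounded[OF assms(1,2)])
qed

section \<open>The linear program\<close>

definition lp_feasible ::
    "'v set \<Rightarrow> 'v set set \<Rightarrow> ('v set \<Rightarrow> real) \<Rightarrow> ('v \<Rightarrow> nat) \<Rightarrow> nat \<Rightarrow> nat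
      \<Rightarrow> (nat \<Rightarrow> 'v set \<Rightarrow> real) \<Rightarrow> (nat \<Rightarrow> 'v set \<Rightarrow> real) \<Rightarrow> bool" where
  "lp_feasible V E p t k C x y \<longleftrightarrow>
     (\<forall>e\<in>E. (\<Sum>h=1..k. y h e) \<le> 1) \<and>
     (\<forall>i\<in>V. (\<Sum>e\<in>{e\<in>E. i \<in> e}. \<Sum>h=1..k. y h e) \<le> real (t i)) \<and>
     (\<forall>h\<in>{1..k}. y h \<in> matching_polytope E C) \<and>
     (\<forall>h\<in>{1..k}. \<forall>e\<in>E. x h e = p e * y h e) \<and>
     (\<forall>i\<in>V. (\<Sum>e\<in>{e\<in>E. i \<in> e}. \<Sum>h=1..k. x h e) \<le> 1)"

definition lp_objective ::
    "'v set set \<Rightarrow> ('v set \<Rightarrow> real) \<Rightarrow> nat \<Rightarrow> (nat \<Rightarrow> 'v set \<Rightarrow> real) \<Rightarrow> real" where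
  "lp_objective E w k x = (\<Sum>e\<in>E. w e * (\<Sum>h=1..k. x h e))"

definition lp_optimal ::
    "'v set \<Rightarrow> 'v set set \<Rightarrow> ('v set \<Rightarrow> real) \<Rightarrow> ('v set \<Rightarrow> real) \<Rightarrow> ('v \<Rightarrow> nat) \<Rightarrow> nat \<Rightarrow> nat
      \<Rightarrow> (nat \<Rightarrow> 'v set \<Rightarrow> real) \<Rightarrow> (nat \<Rightarrow> 'v set \<Rightarrow> real) \<Rightarrow> bool" where
  "lp_optimal V E w p t k C x y \<longleftrightarrow>
     lp_feasible V E p t k C x y \<and>
     (\<forall>x' y'. lp_feasible V E p t k C x' y' \<longrightarrow> lp_objective E w k x' \<le> lp_objective E w k x)"

section \<open>The algorithm\<close>

text \<open>\<open>m h\<close> is the number of matchings in the decomposition of \<open>y h\<close>. The listed probabilities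
  of equal matchings add up.\<close>

definition round_pmf ::
    "real \<Rightarrow> (nat \<Rightarrow> nat) \<Rightarrow> (nat \<Rightarrow> nat \<Rightarrow> real) \<Rightarrow> (nat \<Rightarrow> nat \<Rightarrow> 'v set set) \<Rightarrow> nat
      \<Rightarrow> 'v set set pmf" where
  "round_pmf \<alpha> m lam M h =
     pmf_of_list (({}, 1 - 1 / \<alpha>) # map (\<lambda>l. (M h l, lam h l / \<alpha>)) [1..<Suc (m h)])"

text \<open>After history \<open>H\<close>, the next round is \<open>Suc (length H)\<close>. \<open>run\<close> draws from this distribution
  afresh in every round, which makes the sets \<open>P\<close> of different rounds independent.\<close>

definition lp_algorithm ::
    "'v set set \<Rightarrow> ('v \<Rightarrow> nat) \<Rightarrow> real \<Rightarrow> (nat \<Rightarrow> nat) \<Rightarrow> (nat \<Rightarrow> nat \<Rightarrow> real)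
      \<Rightarrow> (nat \<Rightarrow> nat \<Rightarrow> 'v set set) \<Rightarrow> 'v history \<Rightarrow> 'v set set pmf" where
  "lp_algorithm E t \<alpha> m lam M H =
     map_pmf (\<lambda>P. {e \<in> P. safe E t H e}) (round_pmf \<alpha> m lam M (Suc (length H)))"

end

theory Submission
  imports Defs
begin

text \<open>Whether an edge \<open>e\<close> gets probed is independent of its presence, so under every strategy \<open>e\<close> is
  matched with probability \<open>p e\<close> times the probability \<open>z e\<close> that it is probed. Hence the
  probabilities that \<open>e\<close> is probed in round \<open>h\<close> form a feasible solution of the linear program whose
  value is the expected weight of the strategy, and the optimum of the program is at least \<open>opt\<close>.

  For the algorithm, \<open>z e\<close> is at most \<open>1 / \<alpha>\<close> times \<open>\<Sum>h. y h e\<close>. So at the start of a round each of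
  the following five events has probability at most \<open>1 / \<alpha>\<close>: \<open>e\<close> was probed, one of its two ends is
  matched (a union bound and the last constraint), one of its two ends has timed out (Markov's
  inequality and the patience constraint). Since the choice of \<open>P\<close> in round \<open>h\<close> is independent of
  the past, \<open>e\<close> is probed in that round with probability at least \<open>y h e / \<alpha> * (1 - 5 / \<alpha>)\<close>, and
  \<open>\<alpha> = 10\<close> turns the factor into \<open>1 / 20\<close>.\<close>

section \<open>Expectations over random sets\<close>

lemma measure_bind_pmf:
  "measure_pmf.prob (bind_pmf D f) X = (\<integral>x. measure_pmf.prob (f x) X \<partial>measure_pmf D)"
  unfolding measure_pmf_bind
  by (subst measure_pmf.measure_bind[where N = "count_space UNIV"])
     (auto simp: space_subprob_algebra prob_space_imp_subprob_space measure_pmf.prob_space_axioms)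

lemma expectation_sum_random_set:
  fixes f :: "'e \<Rightarrow> real"
  assumes "finite E" and "\<And>\<omega>. \<omega> \<in> set_pmf D \<Longrightarrow> S \<omega> \<subseteq> E"
  shows "measure_pmf.expectation D (\<lambda>\<omega>. \<Sum>e\<in>S \<omega>. f e)
       = (\<Sum>e\<in>E. f e * measure_pmf.prob D {\<omega>. e \<in> S \<omega>})"
proof -
  have "measure_pmf.expectation D (\<lambda>\<omega>. \<Sum>e\<in>S \<omega>. f e)
      = measure_pmf.expectation D (\<lambda>\<omega>. \<Sum>e\<in>E. f e * indicator {\<omega>. e \<in> S \<omega>} \<omega>)"
  proof (intro integral_cong_AE)
    show "AE \<omega> in measure_pmf D. (\<Sum>e\<in>S \<omega>. f e) = (\<Sum>e\<in>E. f e * indicator {\<omega>. e \<in> S \<omega>} \<omega>)"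
      unfolding AE_measure_pmf_iff
      by (intro ballI sum.mono_neutral_cong_left assms) (auto dest: assms(2))
  qed auto
  also have "\<dots> = (\<Sum>e\<in>E. f e * measure_pmf.prob D {\<omega>. e \<in> S \<omega>})"
  proof (subst Bochner_Integration.integral_sum)
    show "integrable (measure_pmf D) (\<lambda>\<omega>. f e * indicator {\<omega>. e \<in> S \<omega>} \<omega>)" for e
      by (intro measure_pmf.integrable_const_bound[where B = "\<bar>f e\<bar>"]) (auto simp: indicator_def)
  qed simp
  finally show ?thesis .
qed

section \<open>Independence of probing and presence\<close>

text \<open>Tossing the coin of \<open>e\<close> separately from the others is what allows
  conditioning on its presence in \<open>expectation_present_edge\<close>.\<close>

lemma present_edges_insert:
  assumes "finite E" and "e \<notin> E"
  shows "present_edges (insert e E) p =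
    bind_pmf (bernoulli_pmf (p e))
      (\<lambda>b. map_pmf (\<lambda>A. if b then insert e A else A) (present_edges E p))"
  unfolding present_edges_def Pi_pmf_insert'[OF assms] map_bind_pmf map_pmf_comp map_return_pmf
  by (auto intro!: bind_pmf_cong simp: map_pmf_def bind_assoc_pmf bind_return_pmf)
     (use assms in \<open>auto intro!: bind_pmf_cong arg_cong[where f = return_pmf]\<close>)

lemma set_pmf_present_edges: "A \<in> set_pmf (present_edges E p) \<Longrightarrow> A \<subseteq> E"
  by (auto simp: present_edges_def)

text \<open>The assumption on \<open>g\<close> says that \<open>g\<close> ignores whether
  \<open>e\<close> is present, so it is independent of the coin of \<open>e\<close> and the
  expectation of the product factorizes.\<close>

lemma expectation_present_edge:
  fixes g :: "'e set \<Rightarrow> real"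
  assumes "finite E" and "e \<in> E" and p: "0 \<le> p e" "p e \<le> 1"
    and g: "\<And>A. g (A - {e}) = g A"
  shows "measure_pmf.expectation (present_edges E p) (\<lambda>A. indicator A e * g A)
       = p e * measure_pmf.expectation (present_edges E p) g"
proof -
  define F where "F = E - {e}"
  then have F: "finite F" "e \<notin> F" "E = insert e F" using assms by auto
  have supp: "finite (set_pmf (present_edges G p))" if "finite G" for G
    by (rule finite_subset[of _ "Pow G"]) (use that set_pmf_present_edges in \<open>auto\<close>)
  have fin: "finite (set_pmf (present_edges F p))" using F supp by blast
  have split: "measure_pmf.expectation (present_edges E p) h
      = p e * measure_pmf.expectation (present_edges F p) (\<lambda>A. h (insert e A))
      + (1 - p e) * measure_pmf.expectation (present_edges F p) h" for h :: "'e set \<Rightarrow> real"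
    unfolding F(3) present_edges_insert[OF F(1,2)]
    using p fin by (subst pmf_expectation_bind[where A = UNIV]) (auto simp: UNIV_bool)
  have "g (insert e A) = g A" for A
    using g[of A] g[of "insert e A"] by simp
  moreover have "measure_pmf.expectation (present_edges F p) (\<lambda>A. indicator A e * g A) = 0"
    using F(2) set_pmf_present_edges[of _ F p]
    by (intro integral_eq_zero_AE) (auto simp: AE_measure_pmf_iff indicator_def)
  ultimately show ?thesis
    by (simp add: split algebra_simps)
qed

text \<open>A history in which \<open>e\<close> has not been probed carries no information on the presence of \<open>e\<close>.\<close>

lemma nn_integral_run_remove:
  fixes f :: "'v history \<Rightarrow> ennreal"
  assumes "\<And>H. e \<in> probed H \<Longrightarrow> f H = 0"
  shows "(\<integral>\<^sup>+H. f H \<partial>measure_pmf (run \<sigma> (A - {e}) n)) = (\<integral>\<^sup>+H. f H \<partial>measure_pmf (run \<sigma> A n))"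
  using assms
proof (induction n arbitrary: f)
  case (Suc n)
  have "f (H @ [(Q, Q \<inter> (A - {e}))]) = f (H @ [(Q, Q \<inter> A)])" for H Q
  proof (cases "e \<in> Q")
    case True
    then show ?thesis by (simp add: Suc.prems probed_def)
  next
    case False
    then have "Q \<inter> (A - {e}) = Q \<inter> A" by auto
    then show ?thesis by simp
  qed
  \<comment> \<open>The induction hypothesis is applied to the integral over the last round, as a
    function of the earlier history; this function must again vanish once \<open>e\<close> has been
    probed.\<close>
  moreover have "(\<integral>\<^sup>+Q. f (H @ [(Q, Q \<inter> A)]) \<partial>measure_pmf (\<sigma> H)) = 0" if "e \<in> probed H" for H
    using that Suc.prems by (simp add: probed_def)
  ultimately show ?case
    using Suc.IH[of "\<lambda>H. \<integral>\<^sup>+Q. f (H @ [(Q, Q \<inter> A)]) \<partial>measure_pmf (\<sigma> H)"] by simp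
qed simp

text \<open>The preceding lemma covers only functions that vanish once \<open>e\<close> is probed,
  so it is applied to the complementary event.\<close>

lemma prob_probed_remove:
  "measure_pmf.prob (run \<sigma> (A - {e}) n) {H. e \<in> probed H}
     = measure_pmf.prob (run \<sigma> A n) {H. e \<in> probed H}"
proof -
  have "emeasure (run \<sigma> (A - {e}) n) {H. e \<notin> probed H} = emeasure (run \<sigma> A n) {H. e \<notin> probed H}"
    using nn_integral_run_remove[of e "indicator {H. e \<notin> probed H}" \<sigma> A n] by simp
  then have "measure_pmf.prob (run \<sigma> (A - {e}) n) {H. e \<notin> probed H}
      = measure_pmf.prob (run \<sigma> A n) {H. e \<notin> probed H}"
    by (simp add: measure_def)
  moreover have "measure_pmf.prob D {H. e \<in> probed H} = 1 - measure_pmf.prob D {H. e \<notin> probed H}"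
    for D :: "'a history pmf"
  proof -
    have "{H. e \<in> probed H} = UNIV - {H. e \<notin> probed H}" by auto
    then show ?thesis
      using measure_pmf.prob_compl[of "{H. e \<notin> probed H}" D] by simp
  qed
  ultimately show ?thesis by simp
qed

text \<open>For \<open>n = k\<close> this is the distribution behind \<open>expected_weight\<close>;
  a smaller \<open>n\<close> gives the state in which round \<open>n + 1\<close> is chosen.\<close>

definition history_pmf ::
    "'v set set \<Rightarrow> ('v set \<Rightarrow> real) \<Rightarrow> ('v history \<Rightarrow> 'v set set pmf) \<Rightarrow> nat \<Rightarrow> 'v history pmf" where
  "history_pmf E p \<sigma> n = bind_pmf (present_edges E p) (\<lambda>A. run \<sigma> A n)"

lemma run_matched_eq: "H \<in> set_pmf (run \<sigma> A n) \<Longrightarrow> matched H = probed H \<inter> A"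
proof (induction n arbitrary: H)
  case (Suc n)
  then show ?case by (fastforce simp: matched_def probed_def)
qed (simp add: matched_def probed_def)

text \<open>For a fixed set \<open>A\<close> of present edges, being matched means being probed and
  lying in \<open>A\<close>. By \<open>prob_probed_remove\<close> the probability of being probed
  does not change when \<open>e\<close> is removed from \<open>A\<close>, so
  \<open>expectation_present_edge\<close> applies.\<close>

lemma prob_matched:
  assumes "finite E" and "e \<in> E" and "0 \<le> p e" "p e \<le> 1"
  shows "measure_pmf.prob (history_pmf E p \<sigma> n) {H. e \<in> matched H}
       = p e * measure_pmf.prob (history_pmf E p \<sigma> n) {H. e \<in> probed H}"
proof -
  have "measure_pmf.prob (run \<sigma> A n) {H. e \<in> matched H}
      = indicator A e * measure_pmf.prob (run \<sigma> A n) {H. e \<in> probed H}" for A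
  proof -
    have "measure_pmf.prob (run \<sigma> A n) {H. e \<in> matched H}
        = measure_pmf.prob (run \<sigma> A n) {H. e \<in> probed H \<and> e \<in> A}"
      by (intro measure_pmf.finite_measure_eq_AE) (auto simp: AE_measure_pmf_iff run_matched_eq)
    then show ?thesis by (auto simp: indicator_def)
  qed
  then show ?thesis
    unfolding history_pmf_def measure_bind_pmf
    using expectation_present_edge[where g = "\<lambda>A. measure_pmf.prob (run \<sigma> A n) {H. e \<in> probed H}"]
      assms prob_probed_remove by fastforce
qed

section \<open>Invariants of histories and the weight of a strategy\<close>

lemma history_pmf_invariants:
  assumes \<sigma>: "\<sigma> \<in> strategies E t k C" and n: "n \<le> k" and H: "H \<in> set_pmf (history_pmf E p \<sigma> n)"
  shows "length H = n" and "probed H \<subseteq> E" and "matched H \<subseteq> probed H"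
    and "pairwise disjnt (matched H)" and "finite (probed H) \<Longrightarrow> card {e \<in> probed H. v \<in> e} \<le> t v"
proof -
  obtain A where A: "H \<in> set_pmf (run \<sigma> A n)"
    using H by (auto simp: history_pmf_def)
  have "length H = n \<and> probed H \<subseteq> E \<and> matched H \<subseteq> probed H \<and> pairwise disjnt (matched H)
      \<and> (finite (probed H) \<longrightarrow> card {e \<in> probed H. v \<in> e} \<le> t v)"
    using n A
  proof (induction n arbitrary: H)
    case 0
    then show ?case by (simp add: matched_def probed_def)
  next
    case (Suc n)
    from Suc.prems(2) obtain H' Q where H': "H' \<in> set_pmf (run \<sigma> A n)" and Q: "Q \<in> set_pmf (\<sigma> H')"
      and H: "H = H' @ [(Q, Q \<inter> A)]" by auto
    have IH: "length H' = n" "probed H' \<subseteq> E" "matched H' \<subseteq> probed H'" "pairwise disjnt (matched H')"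
      "finite (probed H') \<Longrightarrow> card {e \<in> probed H'. v \<in> e} \<le> t v"
      using Suc.IH[OF _ H'] Suc.prems(1) by auto
    then have "length H' < k" using Suc.prems(1) by simp
    with \<sigma> Q have "Q \<in> matchings E C" and safe: "\<And>e. e \<in> Q \<Longrightarrow> safe E t H' e"
      unfolding strategies_def by blast+
    then have QE: "Q \<subseteq> E" and dj: "pairwise disjnt Q" by (auto simp: matchings_def)
    have pr: "probed H = probed H' \<union> Q" and ma: "matched H = matched H' \<union> (Q \<inter> A)"
      by (auto simp: H probed_def matched_def)
    have "disjnt e e' \<and> disjnt e' e" if "e \<in> Q" "e' \<in> matched H'" for e e'
      using safe[OF that(1)] that(2) by (auto simp: safe_def disjnt_iff)
    then have "pairwise disjnt (matched H)"
      using IH(4) dj unfolding ma pairwise_def by (simp add: Ball_def)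
    moreover have "card {e \<in> probed H. v \<in> e} \<le> t v" if fin: "finite (probed H)"
    proof (cases "\<exists>e\<in>Q. v \<in> e")
      case True
      then obtain e where e: "e \<in> Q" "v \<in> e" by blast
      \<comment> \<open>Since \<open>Q\<close> is a matching, a round adds only one edge at
        \<open>v\<close>, and its safety before the round leaves room for it.\<close>
      have "{e \<in> probed H. v \<in> e} = insert e {e \<in> probed H'. v \<in> e}"
        using e dj by (auto simp: pr pairwise_def disjnt_iff)
      moreover have "card {e \<in> probed H'. v \<in> e} < t v"
        using safe[OF e(1)] e(2) by (auto simp: safe_def timed_out_def)
      ultimately show ?thesis
        by (auto intro: card_insert_le_m1)
    next
      case False
      then have "{e \<in> probed H. v \<in> e} = {e \<in> probed H'. v \<in> e}" by (auto simp: pr)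
      then show ?thesis using IH(5) fin by (simp add: pr)
    qed
    moreover have "length H = Suc n" "probed H \<subseteq> E" "matched H \<subseteq> probed H"
      using IH(1) by (simp add: H) (use IH(2,3) QE in \<open>auto simp: pr ma\<close>)
    ultimately show ?case by blast
  qed
  then show "length H = n" and "probed H \<subseteq> E" and "matched H \<subseteq> probed H"
    and "pairwise disjnt (matched H)" and "finite (probed H) \<Longrightarrow> card {e \<in> probed H. v \<in> e} \<le> t v"
    by auto
qed

lemma expected_weight_eq:
  assumes "finite E" and "\<And>e. e \<in> E \<Longrightarrow> 0 \<le> p e \<and> p e \<le> 1" and \<sigma>: "\<sigma> \<in> strategies E t k C"
  shows "expected_weight E w p k \<sigma>
       = (\<Sum>e\<in>E. w e * (p e * measure_pmf.prob (history_pmf E p \<sigma> k) {H. e \<in> probed H}))"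
proof -
  have "matched H \<subseteq> E" if "H \<in> set_pmf (history_pmf E p \<sigma> k)" for H
    using history_pmf_invariants(2,3)[OF \<sigma> order_refl that] by blast
  then have "expected_weight E w p k \<sigma>
      = (\<Sum>e\<in>E. w e * measure_pmf.prob (history_pmf E p \<sigma> k) {H. e \<in> matched H})"
    unfolding expected_weight_def history_pmf_def[symmetric]
    by (rule expectation_sum_random_set[OF assms(1)])
  also have "\<dots> = (\<Sum>e\<in>E. w e * (p e * measure_pmf.prob (history_pmf E p \<sigma> k) {H. e \<in> probed H}))"
    using assms(2) by (intro sum.cong refl arg_cong2[where f = times] prob_matched assms(1)) auto
  finally show ?thesis .
qed

section \<open>The linear program bounds the optimum\<close>

lemma lookup_scaleR: "Poly_Mapping.lookup (r *\<^sub>R z) e = r * Poly_Mapping.lookup z e"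
proof -
  have "finite {i. r * Poly_Mapping.lookup z i \<noteq> 0}"
    by (rule finite_subset[OF _ finite_lookup[of z]]) auto
  then show ?thesis by (simp add: scaleR_poly_mapping_def)
qed

text \<open>The marginals are the mean of the random characteristic vector, that is, its convex
  combination with weights \<open>pmf R M\<close>.\<close>

lemma matching_polytope_marginals:
  assumes "finite E" and supp: "set_pmf R \<subseteq> matchings E C"
  shows "(\<lambda>e. measure_pmf.prob R {Q. e \<in> Q}) \<in> matching_polytope E C"
proof -
  define z where "z = (\<Sum>M\<in>matchings E C. pmf R M *\<^sub>R char_vec M)"
  have fin: "finite (matchings E C)"
    by (rule finite_subset[of _ "Pow E"]) (use assms in \<open>auto simp: matchings_def\<close>)
  have "z \<in> convex hull (char_vec ` matchings E C)"
    unfolding z_def using fin supp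
    by (intro convex_sum sum_pmf_eq_1) (auto intro: hull_inc convex_convex_hull)
  moreover have "measure_pmf.prob R {Q. e \<in> Q} = Poly_Mapping.lookup z e" for e
  proof -
    have "measure_pmf.prob R {Q. e \<in> Q} = measure_pmf.prob R {Q \<in> matchings E C. e \<in> Q}"
      using supp by (intro measure_pmf.finite_measure_eq_AE) (auto simp: AE_measure_pmf_iff)
    also have "\<dots> = (\<Sum>M\<in>{Q \<in> matchings E C. e \<in> Q}. pmf R M)"
      using fin by (simp add: measure_measure_pmf_finite)
    also have "\<dots> = (\<Sum>M\<in>matchings E C. pmf R M * indicator M e)"
      using fin by (intro sum.mono_neutral_cong_left) auto
    also have "\<dots> = Poly_Mapping.lookup z e"
      unfolding z_def lookup_sum lookup_scaleR
      by (intro sum.cong refl)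
         (use \<open>finite E\<close> in \<open>auto simp: lookup_char_vec matchings_def dest: finite_subset\<close>)
    finally show ?thesis .
  qed
  ultimately show ?thesis by (auto simp: matching_polytope_def)
qed

text \<open>A probed edge is no longer safe, so being probed earlier and being probed in the new
  round are disjoint events.\<close>

lemma prob_probed_Suc:
  assumes \<sigma>: "\<sigma> \<in> strategies E t k C" and n: "n < k"
  shows "measure_pmf.prob (history_pmf E p \<sigma> (Suc n)) {H. e \<in> probed H}
       = measure_pmf.prob (history_pmf E p \<sigma> n) {H. e \<in> probed H}
       + measure_pmf.prob (bind_pmf (history_pmf E p \<sigma> n) \<sigma>) {Q. e \<in> Q}"
proof -
  let ?D = "history_pmf E p \<sigma> n"
  have *: "measure_pmf.prob (\<sigma> H) {Q. e \<in> probed H \<union> Q}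
      = indicator {H. e \<in> probed H} H + measure_pmf.prob (\<sigma> H) {Q. e \<in> Q}"
    if "H \<in> set_pmf ?D" for H
  proof (cases "e \<in> probed H")
    case True
    have "length H < k" using history_pmf_invariants(1)[OF \<sigma> _ that] n by simp
    then have "\<forall>Q\<in>set_pmf (\<sigma> H). e \<notin> Q"
      using \<sigma> True by (auto simp: strategies_def safe_def)
    then have "measure_pmf.prob (\<sigma> H) {Q. e \<in> Q} = 0"
      by (auto simp: measure_pmf_zero_iff)
    then show ?thesis using True by simp
  qed simp
  \<comment> \<open>Forgetting the answers of the last round removes its dependence on the present
    edges, so the inner bind collapses to the history after \<open>n\<close> rounds.\<close>
  have "map_pmf probed (history_pmf E p \<sigma> (Suc n))
      = bind_pmf ?D (\<lambda>H. map_pmf (\<lambda>Q. probed H \<union> Q) (\<sigma> H))"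
    by (auto simp: history_pmf_def bind_assoc_pmf map_bind_pmf map_pmf_comp probed_def
          intro!: bind_pmf_cong map_pmf_cong)
  then have "measure_pmf.prob (history_pmf E p \<sigma> (Suc n)) {H. e \<in> probed H}
      = measure_pmf.prob (bind_pmf ?D (\<lambda>H. map_pmf (\<lambda>Q. probed H \<union> Q) (\<sigma> H))) {S. e \<in> S}"
    by (metis (no_types, lifting) measure_map_pmf vimage_Collect_eq Collect_cong)
  also have "\<dots> = (\<integral>H. measure_pmf.prob (\<sigma> H) {Q. e \<in> probed H \<union> Q} \<partial>measure_pmf ?D)"
    by (simp add: measure_bind_pmf vimage_def)
  also have "\<dots> = (\<integral>H. indicator {H. e \<in> probed H} H + measure_pmf.prob (\<sigma> H) {Q. e \<in> Q} \<partial>measure_pmf ?D)"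
    by (intro integral_cong_AE AE_pmfI) (simp_all add: * del: Un_iff)
  also have "\<dots> = measure_pmf.prob ?D {H. e \<in> probed H} + measure_pmf.prob (bind_pmf ?D \<sigma>) {Q. e \<in> Q}"
    by (subst Bochner_Integration.integral_add)
       (auto simp: measure_bind_pmf intro!: measure_pmf.integrable_const_bound[where B = 1])
  finally show ?thesis .
qed

text \<open>Round \<open>h\<close> is chosen after \<open>h - 1\<close> rounds, so its summand is
  the probability that \<open>e\<close> is probed in exactly that round.\<close>

lemma prob_probed_eq_sum:
  assumes \<sigma>: "\<sigma> \<in> strategies E t k C" and n: "n \<le> k"
  shows "measure_pmf.prob (history_pmf E p \<sigma> n) {H. e \<in> probed H}
       = (\<Sum>h=1..n. measure_pmf.prob (bind_pmf (history_pmf E p \<sigma> (h - 1)) \<sigma>) {Q. e \<in> Q})"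
  using n
proof (induction n)
  case 0
  have "measure_pmf.prob (history_pmf E p \<sigma> 0) {H. e \<in> probed H} = 0"
    by (auto simp: history_pmf_def probed_def measure_pmf_zero_iff)
  then show ?case by simp
next
  case (Suc n)
  then show ?case by (simp add: prob_probed_Suc[OF \<sigma>])
qed

lemma expectation_incident:
  assumes "finite E" and "\<And>\<omega>. \<omega> \<in> set_pmf D \<Longrightarrow> S \<omega> \<subseteq> E"
  shows "measure_pmf.expectation D (\<lambda>\<omega>. real (card {e \<in> S \<omega>. v \<in> e}))
       = (\<Sum>e\<in>{e \<in> E. v \<in> e}. measure_pmf.prob D {\<omega>. e \<in> S \<omega>})" (is "?L = ?R")
    and "integrable (measure_pmf D) (\<lambda>\<omega>. real (card {e \<in> S \<omega>. v \<in> e}))"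
proof -
  have "?L = measure_pmf.expectation D (\<lambda>\<omega>. \<Sum>e\<in>{e \<in> S \<omega>. v \<in> e}. 1)"
    by simp
  also have "\<dots> = (\<Sum>e\<in>{e \<in> E. v \<in> e}. 1 * measure_pmf.prob D {\<omega>. e \<in> {e \<in> S \<omega>. v \<in> e}})"
    by (intro expectation_sum_random_set) (use assms in auto)
  also have "\<dots> = ?R"
    by (intro sum.cong) auto
  finally show "?L = ?R" .
  show "integrable (measure_pmf D) (\<lambda>\<omega>. real (card {e \<in> S \<omega>. v \<in> e}))"
    by (intro measure_pmf.integrable_const_bound[where B = "real (card E)"] AE_pmfI)
       (use assms in \<open>auto intro!: card_mono dest: assms(2)\<close>)
qed

text \<open>A degree bound on every outcome passes to the marginals. With probed edges it yields the
  patience constraint, with matched edges the last constraint of the program.\<close>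

lemma expected_incident_le:
  assumes "finite E" and "\<And>\<omega>. \<omega> \<in> set_pmf D \<Longrightarrow> S \<omega> \<subseteq> E \<and> card {e \<in> S \<omega>. v \<in> e} \<le> b"
  shows "(\<Sum>e\<in>{e \<in> E. v \<in> e}. measure_pmf.prob D {\<omega>. e \<in> S \<omega>}) \<le> real b"
proof -
  have "measure_pmf.expectation D (\<lambda>\<omega>. real (card {e \<in> S \<omega>. v \<in> e})) \<le> real b"
    by (intro measure_pmf.integral_le_const expectation_incident(2)[OF assms(1)] AE_pmfI)
       (use assms(2) in auto)
  then show ?thesis
    by (subst (asm) expectation_incident(1)[OF assms(1)]) (use assms(2) in auto)
qed

lemma card_disjoint_incident_le:
  assumes "pairwise disjnt S"
  shows "card {e \<in> S. v \<in> e} \<le> 1"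
proof -
  have "e = e'" if "e \<in> {e \<in> S. v \<in> e}" "e' \<in> {e \<in> S. v \<in> e}" for e e'
    using that assms by (auto simp: pairwise_def disjnt_iff)
  then show ?thesis
    by (cases "finite {e \<in> S. v \<in> e}") (simp_all add: card_le_Suc0_iff_eq)
qed

lemma opt_le_lp_objective:
  assumes fin: "finite E" and p: "\<And>e. e \<in> E \<Longrightarrow> 0 \<le> p e \<and> p e \<le> 1"
    and optimal: "lp_optimal V E w p t k C x y"
  shows "opt E w p t k C \<le> lp_objective E w k x"
  unfolding opt_def
proof (rule cSUP_least)
  show "strategies E t k C \<noteq> {}"
    using strategies_nonempty by blast
next
  fix \<sigma> assume \<sigma>: "\<sigma> \<in> strategies E t k C"
  \<comment> \<open>The witness for the linear program: \<open>y' h e\<close> is the probability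
    that round \<open>h\<close> probes \<open>e\<close>.\<close>
  define y' where "y' h e = measure_pmf.prob (bind_pmf (history_pmf E p \<sigma> (h - 1)) \<sigma>) {Q. e \<in> Q}" for h e
  define x' where "x' h e = p e * y' h e" for h e
  note inv = history_pmf_invariants[OF \<sigma> order_refl, where p = p]
  \<comment> \<open>Summed over the rounds, \<open>y'\<close> and \<open>x'\<close> become the
    probabilities that \<open>e\<close> is ever probed or matched. The degree constraints then
    follow from bounds that hold in every history.\<close>
  have y': "(\<Sum>h=1..k. y' h e) = measure_pmf.prob (history_pmf E p \<sigma> k) {H. e \<in> probed H}" for e
    unfolding y'_def using prob_probed_eq_sum[OF \<sigma> order_refl] by metis
  have x': "(\<Sum>h=1..k. x' h e) = measure_pmf.prob (history_pmf E p \<sigma> k) {H. e \<in> matched H}"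
    if "e \<in> E" for e
    unfolding x'_def sum_distrib_left[symmetric] y' using that p prob_matched[OF fin that] by auto
  have "y' h \<in> matching_polytope E C" if "h \<in> {1..k}" for h
    unfolding y'_def
  proof (rule matching_polytope_marginals[OF fin])
    show "set_pmf (bind_pmf (history_pmf E p \<sigma> (h - 1)) \<sigma>) \<subseteq> matchings E C"
    proof
      fix Q assume "Q \<in> set_pmf (bind_pmf (history_pmf E p \<sigma> (h - 1)) \<sigma>)"
      then obtain H where H: "H \<in> set_pmf (history_pmf E p \<sigma> (h - 1))" "Q \<in> set_pmf (\<sigma> H)"
        by auto
      from that have "h - 1 < k" by auto
      then have "length H < k"
        using history_pmf_invariants(1)[OF \<sigma> _ H(1)] by simp
      then show "Q \<in> matchings E C"
        using \<sigma> H(2) by (auto simp: strategies_def)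
    qed
  qed
  moreover have "(\<Sum>h=1..k. y' h e) \<le> 1" for e
    by (simp only: y' measure_pmf.prob_le_1)
  moreover have "(\<Sum>e\<in>{e \<in> E. i \<in> e}. \<Sum>h=1..k. y' h e) \<le> real (t i)" for i
    unfolding y' by (intro expected_incident_le[OF fin])
      (use inv(2,5) fin in \<open>blast dest: finite_subset\<close>)
  moreover have "(\<Sum>e\<in>{e \<in> E. i \<in> e}. \<Sum>h=1..k. x' h e) \<le> 1" for i
  proof -
    have "(\<Sum>e\<in>{e \<in> E. i \<in> e}. \<Sum>h=1..k. x' h e)
        = (\<Sum>e\<in>{e \<in> E. i \<in> e}. measure_pmf.prob (history_pmf E p \<sigma> k) {H. e \<in> matched H})"
      by (intro sum.cong refl x') auto
    also have "\<dots> \<le> real 1"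
      by (intro expected_incident_le[OF fin] conjI card_disjoint_incident_le)
         (use inv(2,3,4) in blast)+
    finally show ?thesis by simp
  qed
  ultimately have "lp_feasible V E p t k C x' y'"
    by (simp add: lp_feasible_def x'_def)
  then have "lp_objective E w k x' \<le> lp_objective E w k x"
    using optimal unfolding lp_optimal_def by blast
  moreover have "expected_weight E w p k \<sigma> = lp_objective E w k x'"
    unfolding lp_objective_def x'_def sum_distrib_left[symmetric] y'
    by (rule expected_weight_eq[OF fin p \<sigma>])
  ultimately show "expected_weight E w p k \<sigma> \<le> lp_objective E w k x" by simp
qed

section \<open>The rounding algorithm\<close>

text \<open>The solution is only assumed feasible here; optimality enters through
  \<open>opt_le_lp_objective\<close>. Keeping \<alpha> free shows how the guarantee depends on it,
  and \<open>\<alpha> \<ge> 1\<close> makes \<open>1 - 1 / \<alpha>\<close> a probability.\<close>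

locale lp_rounding =
  fixes V :: "'v set" and E :: "'v set set"
    and p :: "'v set \<Rightarrow> real" and t :: "'v \<Rightarrow> nat" and k C :: nat
    and x y :: "nat \<Rightarrow> 'v set \<Rightarrow> real"
    and m :: "nat \<Rightarrow> nat" and lam :: "nat \<Rightarrow> nat \<Rightarrow> real" and M :: "nat \<Rightarrow> nat \<Rightarrow> 'v set set"
    and \<alpha> :: real
  assumes graph: "simple_graph V E"
    and p: "\<And>e. e \<in> E \<Longrightarrow> 0 \<le> p e \<and> p e \<le> 1"
    and t: "\<And>i. i \<in> V \<Longrightarrow> t i \<ge> 1"
    and feasible: "lp_feasible V E p t k C x y"
    and lam_M: "\<And>h l. h \<in> {1..k} \<Longrightarrow> l \<in> {1..m h} \<Longrightarrow> lam h l > 0 \<and> M h l \<in> matchings E C"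
    and lam_sum: "\<And>h. h \<in> {1..k} \<Longrightarrow> (\<Sum>l=1..m h. lam h l) = 1"
    and y_eq: "\<And>h e. h \<in> {1..k} \<Longrightarrow> e \<in> E \<Longrightarrow> y h e = (\<Sum>l=1..m h. lam h l * indicator (M h l) e)"
    and \<alpha>: "\<alpha> \<ge> 1"
begin

lemma finite_E: "finite E"
  by (rule finite_subset[of _ "Pow V"]) (use graph in \<open>auto simp: simple_graph_def\<close>)

lemma y_nonneg: "h \<in> {1..k} \<Longrightarrow> e \<in> E \<Longrightarrow> 0 \<le> y h e"
  using lam_M by (simp only: y_eq) (intro sum_nonneg mult_nonneg_nonneg; simp add: less_imp_le)

lemma round_pmf_wf:
  assumes h: "h \<in> {1..k}"
  shows "pmf_of_list_wf (({}, 1 - 1 / \<alpha>) # map (\<lambda>l. (M h l, lam h l / \<alpha>)) [1..<Suc (m h)])"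
proof (rule pmf_of_list_wfI)
  have "sum_list (map (\<lambda>l. lam h l / \<alpha>) [1..<Suc (m h)]) = (\<Sum>l=1..m h. lam h l / \<alpha>)"
    by (simp only: interv_sum_list_conv_sum_set_nat set_upt atLeastLessThanSuc_atLeastAtMost)
  also have "\<dots> = 1 / \<alpha>"
    using lam_sum[OF h] by (simp add: sum_divide_distrib[symmetric])
  finally show "sum_list (map snd (({}, 1 - 1 / \<alpha>) # map (\<lambda>l. (M h l, lam h l / \<alpha>)) [1..<Suc (m h)])) = 1"
    by (simp add: comp_def del: upt_Suc)
next
  fix r assume "r \<in> set (map snd (({}, 1 - 1 / \<alpha>) # map (\<lambda>l. (M h l, lam h l / \<alpha>)) [1..<Suc (m h)]))"
  then have "r = 1 - 1 / \<alpha> \<or> (\<exists>l\<in>{1..m h}. r = lam h l / \<alpha>)"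
    by (auto simp del: upt_Suc)
  then show "0 \<le> r"
    using \<alpha> lam_M[OF h] by (auto simp: less_imp_le)
qed

lemma set_round_pmf:
  assumes h: "h \<in> {1..k}"
  shows "set_pmf (round_pmf \<alpha> m lam M h) \<subseteq> matchings E C"
proof -
  have "set_pmf (round_pmf \<alpha> m lam M h) \<subseteq> insert {} (M h ` {1..m h})"
    using set_pmf_of_list[OF round_pmf_wf[OF h]]
    by (simp only: round_pmf_def list.map map_map list.set set_map set_upt comp_def fst_conv
          atLeastLessThanSuc_atLeastAtMost)
  moreover have "{} \<in> matchings E C"
    by (simp add: matchings_def)
  ultimately show ?thesis
    using lam_M[OF h] by blast
qed

text \<open>The leading entry \<open>{}\<close> never contains \<open>e\<close>, and the remaining
  entries are the decomposition of \<open>y h\<close> scaled by \<open>1 / \<alpha>\<close>.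
  Repeated matchings add up on both sides.\<close>

lemma prob_round_pmf:
  assumes h: "h \<in> {1..k}" and e: "e \<in> E"
  shows "measure_pmf.prob (round_pmf \<alpha> m lam M h) {P. e \<in> P} = y h e / \<alpha>"
proof -
  have "measure_pmf.prob (round_pmf \<alpha> m lam M h) {P. e \<in> P}
      = sum_list (map (\<lambda>l. if e \<in> M h l then lam h l / \<alpha> else 0) [1..<Suc (m h)])"
    unfolding round_pmf_def measure_pmf_of_list[OF round_pmf_wf[OF h]]
    by (simp add: sum_list_map_filter' filter_map comp_def del: upt_Suc)
  also have "\<dots> = (\<Sum>l=1..m h. if e \<in> M h l then lam h l / \<alpha> else 0)"
    by (simp only: interv_sum_list_conv_sum_set_nat set_upt atLeastLessThanSuc_atLeastAtMost)
  also have "\<dots> = y h e / \<alpha>"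
    unfolding y_eq[OF h e] sum_divide_distrib by (intro sum.cong) auto
  finally show ?thesis .
qed

abbreviation alg :: "'v history \<Rightarrow> 'v set set pmf" where
  "alg \<equiv> lp_algorithm E t \<alpha> m lam M"

abbreviation D :: "nat \<Rightarrow> 'v history pmf" where
  "D \<equiv> history_pmf E p alg"

lemma alg_strategy: "alg \<in> strategies E t k C"
  unfolding strategies_def
proof (clarify)
  fix H :: "'v history" and Q assume H: "length H < k" and "Q \<in> set_pmf (alg H)"
  then obtain P where P: "P \<in> set_pmf (round_pmf \<alpha> m lam M (Suc (length H)))"
    and Q: "Q = {e \<in> P. safe E t H e}" by (auto simp: lp_algorithm_def)
  have "P \<in> matchings E C"
    using set_round_pmf[of "Suc (length H)"] P H by auto
  then have "Q \<in> matchings E C"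
    using card_mono[of P Q] finite_subset[of P E] finite_E
    unfolding Q matchings_def by (auto intro: pairwise_subset)
  then show "Q \<in> matchings E C \<and> (\<forall>e\<in>Q. safe E t H e)"
    by (simp add: Q)
qed

text \<open>After \<open>n\<close> rounds the law of \<open>P\<close> depends on the history only
  through its length, which is \<open>n\<close>. Hence \<open>e\<close> lying in \<open>P\<close> is
  independent of \<open>e\<close> being safe, and the probabilities multiply.\<close>

lemma prob_selected:
  assumes n: "n < k" and e: "e \<in> E"
  shows "measure_pmf.prob (bind_pmf (D n) alg) {Q. e \<in> Q}
       = y (Suc n) e / \<alpha> * measure_pmf.prob (D n) {H. safe E t H e}"
proof -
  have "measure_pmf.prob (alg H) {Q. e \<in> Q} = y (Suc n) e / \<alpha> * indicator {H. safe E t H e} H"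
    if H: "H \<in> set_pmf (D n)" for H
  proof -
    have "length H = n"
      using history_pmf_invariants(1)[OF alg_strategy _ H] n by simp
    then show ?thesis
      using prob_round_pmf[of "Suc n" e] n e by (auto simp: lp_algorithm_def vimage_def indicator_def)
  qed
  then have "measure_pmf.prob (bind_pmf (D n) alg) {Q. e \<in> Q}
      = measure_pmf.expectation (D n) (\<lambda>H. y (Suc n) e / \<alpha> * indicator {H. safe E t H e} H)"
    unfolding measure_bind_pmf by (intro integral_cong_AE AE_pmfI) auto
  then show ?thesis by simp
qed

section \<open>Bounds on the events that make an edge unsafe\<close>

text \<open>The safety factor in \<open>prob_selected\<close> is bounded by 1. Extending the sum
  from \<open>n\<close> to \<open>k\<close> makes the bound uniform over rounds and matches the
  constraints of the program.\<close>

lemma prob_probed_le: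
  assumes n: "n \<le> k" and e: "e \<in> E"
  shows "measure_pmf.prob (D n) {H. e \<in> probed H} \<le> (\<Sum>h=1..k. y h e) / \<alpha>"
proof -
  have "measure_pmf.prob (D n) {H. e \<in> probed H} \<le> (\<Sum>h=1..n. y h e / \<alpha>)"
    unfolding prob_probed_eq_sum[OF alg_strategy n]
  proof (rule sum_mono)
    fix h assume h: "h \<in> {1..n}"
    \<comment> \<open>\<open>prob_selected\<close> speaks about round \<open>Suc n\<close>, so it is
      used with \<open>n = h - 1\<close>, which is legitimate because rounds start at 1.\<close>
    then have "h - 1 < k" "Suc (h - 1) = h" using n by auto
    note sel = prob_selected[OF this(1) e, unfolded this(2)]
    have "measure_pmf.prob (bind_pmf (D (h - 1)) alg) {Q. e \<in> Q}
        = y h e / \<alpha> * measure_pmf.prob (D (h - 1)) {H. safe E t H e}"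
      by (rule sel)
    also have "\<dots> \<le> y h e / \<alpha>"
      using h n y_nonneg[OF _ e, of h] \<alpha> by (intro mult_left_le) auto
    finally show "measure_pmf.prob (bind_pmf (D (h - 1)) alg) {Q. e \<in> Q} \<le> y h e / \<alpha>" .
  qed
  also have "\<dots> \<le> (\<Sum>h=1..k. y h e / \<alpha>)"
    using n \<alpha> y_nonneg[OF _ e] by (intro sum_mono2) auto
  finally show ?thesis by (simp add: sum_divide_distrib)
qed

text \<open>The factor \<open>p e\<close> from \<open>prob_matched\<close> turns the bound in terms
  of \<open>y\<close> into one in terms of \<open>x\<close>, whose total at a vertex is at most
  1.\<close>

lemma prob_vertex_matched_le:
  assumes n: "n \<le> k" and v: "v \<in> V"
  shows "measure_pmf.prob (D n) {H. v \<in> \<Union>(matched H)} \<le> 1 / \<alpha>"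
proof -
  have "measure_pmf.prob (D n) {H. v \<in> \<Union>(matched H)}
      \<le> measure_pmf.prob (D n) (\<Union>e\<in>{e \<in> E. v \<in> e}. {H. e \<in> matched H})"
    using history_pmf_invariants(2,3)[OF alg_strategy n, of _ p]
    by (intro measure_pmf.finite_measure_mono_AE AE_pmfI) fastforce+
  also have "\<dots> \<le> (\<Sum>e\<in>{e \<in> E. v \<in> e}. measure_pmf.prob (D n) {H. e \<in> matched H})"
    using finite_E by (intro measure_pmf.finite_measure_subadditive_finite) auto
  also have "\<dots> \<le> (\<Sum>e\<in>{e \<in> E. v \<in> e}. (\<Sum>h=1..k. x h e) / \<alpha>)"
  proof (rule sum_mono)
    fix e assume e: "e \<in> {e \<in> E. v \<in> e}"
    have "measure_pmf.prob (D n) {H. e \<in> matched H} = p e * measure_pmf.prob (D n) {H. e \<in> probed H}"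
      using e p prob_matched[OF finite_E] by auto
    also have "\<dots> \<le> p e * ((\<Sum>h=1..k. y h e) / \<alpha>)"
      using e p n by (intro mult_left_mono prob_probed_le) auto
    also have "\<dots> = (\<Sum>h=1..k. x h e) / \<alpha>"
      using e feasible by (simp add: lp_feasible_def sum_distrib_left)
    finally show "measure_pmf.prob (D n) {H. e \<in> matched H} \<le> (\<Sum>h=1..k. x h e) / \<alpha>" .
  qed
  also have "\<dots> = (\<Sum>e\<in>{e \<in> E. v \<in> e}. \<Sum>h=1..k. x h e) / \<alpha>"
    by (simp only: sum_divide_distrib)
  also have "\<dots> \<le> 1 / \<alpha>"
    using feasible v \<alpha> by (intro divide_right_mono) (auto simp: lp_feasible_def)
  finally show ?thesis .
qed

lemma prob_timed_out_le:
  assumes n: "n \<le> k" and v: "v \<in> V"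
  shows "measure_pmf.prob (D n) {H. timed_out t H v} \<le> 1 / \<alpha>"
proof -
  have probed: "probed H \<subseteq> E" if "H \<in> set_pmf (D n)" for H
    using history_pmf_invariants(2)[OF alg_strategy n that] .
  \<comment> \<open>The patience is the threshold in Markov's inequality and cancels at the end, so
    it has to be positive.\<close>
  have t_pos: "0 < real (t v)" using t[OF v] by simp
  have "measure_pmf.prob (D n) {H. timed_out t H v}
      \<le> measure_pmf.expectation (D n) (\<lambda>H. real (card {e \<in> probed H. v \<in> e})) / real (t v)"
    using integral_Markov_inequality_measure[OF expectation_incident(2)[OF finite_E probed, where v = v], where A = UNIV and c = "real (t v)"]
      t_pos by (simp add: timed_out_def)
  also have "\<dots> = (\<Sum>e\<in>{e \<in> E. v \<in> e}. measure_pmf.prob (D n) {H. e \<in> probed H}) / real (t v)"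
    by (subst expectation_incident(1)[OF finite_E probed]) auto
  also have "\<dots> \<le> (\<Sum>e\<in>{e \<in> E. v \<in> e}. (\<Sum>h=1..k. y h e) / \<alpha>) / real (t v)"
    using n by (intro divide_right_mono sum_mono prob_probed_le) auto
  also have "\<dots> = (\<Sum>e\<in>{e \<in> E. v \<in> e}. \<Sum>h=1..k. y h e) / \<alpha> / real (t v)"
    by (simp only: sum_divide_distrib)
  also have "\<dots> \<le> real (t v) / \<alpha> / real (t v)"
    using feasible v \<alpha> by (intro divide_right_mono) (auto simp: lp_feasible_def)
  finally show ?thesis using t_pos by simp
qed

lemma prob_safe_ge:
  assumes n: "n \<le> k" and e: "e \<in> E"
  shows "measure_pmf.prob (D n) {H. safe E t H e} \<ge> 1 - 5 / \<alpha>"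
proof -
  \<comment> \<open>Each of the two ends of \<open>e\<close> contributes two bad events, so the
    constant 5 arises as 1 + 2 * 2.\<close>
  let ?bad = "\<lambda>v. {H. v \<in> \<Union>(matched H)} \<union> {H. timed_out t H v}"
  have eV: "e \<subseteq> V" "card e = 2" "finite e"
    using graph e by (auto simp: simple_graph_def intro: finite_subset)
  have "1 - measure_pmf.prob (D n) {H. safe E t H e} = measure_pmf.prob (D n) (- {H. safe E t H e})"
    using measure_pmf.prob_compl[of "{H. safe E t H e}" "D n"] by (simp add: Compl_eq_Diff_UNIV)
  also have "- {H. safe E t H e} = {H. e \<in> probed H} \<union> (\<Union>v\<in>e. ?bad v)"
    using e by (auto simp: safe_def)
  also have "measure_pmf.prob (D n) \<dots>
      \<le> measure_pmf.prob (D n) {H. e \<in> probed H} + measure_pmf.prob (D n) (\<Union>v\<in>e. ?bad v)"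
    by (intro measure_Un_le) auto
  also have "measure_pmf.prob (D n) (\<Union>v\<in>e. ?bad v) \<le> (\<Sum>v\<in>e. measure_pmf.prob (D n) (?bad v))"
    using eV by (intro measure_pmf.finite_measure_subadditive_finite) auto
  also have "\<dots> \<le> (\<Sum>v\<in>e. 1 / \<alpha> + 1 / \<alpha>)"
  proof (rule sum_mono)
    fix v assume "v \<in> e"
    then have "v \<in> V" using eV by auto
    then show "measure_pmf.prob (D n) (?bad v) \<le> 1 / \<alpha> + 1 / \<alpha>"
      by (intro order_trans[OF measure_Un_le] add_mono
            prob_vertex_matched_le prob_timed_out_le n) auto
  qed
  also have "measure_pmf.prob (D n) {H. e \<in> probed H} \<le> 1 / \<alpha>"
    using prob_probed_le[OF n e] feasible e \<alpha>
    by (elim order_trans, intro divide_right_mono) (auto simp: lp_feasible_def)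
  finally show ?thesis using eV by simp
qed

section \<open>The approximation guarantee\<close>

text \<open>Both sides are sums over edges and rounds and are compared term by term. The factor
  \<open>(1 - 5 / \<alpha>) / \<alpha>\<close> is largest at \<open>\<alpha> = 10\<close>.\<close>

lemma expected_weight_alg_ge:
  assumes w: "\<And>e. e \<in> E \<Longrightarrow> w e \<ge> 0"
  shows "expected_weight E w p k alg \<ge> (1 - 5 / \<alpha>) / \<alpha> * lp_objective E w k x"
proof -
  have "(1 - 5 / \<alpha>) / \<alpha> * lp_objective E w k x
      = (\<Sum>e\<in>E. w e * (p e * (\<Sum>h=1..k. y h e / \<alpha> * (1 - 5 / \<alpha>))))"
    unfolding lp_objective_def sum_distrib_left
    by (intro sum.cong) (use feasible in \<open>auto simp: lp_feasible_def\<close>)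
  also have "\<dots> \<le> (\<Sum>e\<in>E. w e * (p e * measure_pmf.prob (D k) {H. e \<in> probed H}))"
  proof (intro sum_mono mult_left_mono)
    fix e assume e: "e \<in> E"
    show "(\<Sum>h=1..k. y h e / \<alpha> * (1 - 5 / \<alpha>)) \<le> measure_pmf.prob (D k) {H. e \<in> probed H}"
      unfolding prob_probed_eq_sum[OF alg_strategy order_refl]
    proof (rule sum_mono)
      fix h assume h: "h \<in> {1..k}"
      then have "h - 1 < k" "Suc (h - 1) = h" by auto
      note sel = prob_selected[OF this(1) e, unfolded this(2)]
      have "y h e / \<alpha> * (1 - 5 / \<alpha>) \<le> y h e / \<alpha> * measure_pmf.prob (D (h - 1)) {H. safe E t H e}"
        using h e \<alpha> y_nonneg[OF h e] by (intro mult_left_mono prob_safe_ge) auto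
      then show "y h e / \<alpha> * (1 - 5 / \<alpha>) \<le> measure_pmf.prob (bind_pmf (D (h - 1)) alg) {Q. e \<in> Q}"
        by (simp only: sel)
    qed
  qed (use w p in auto)
  also have "\<dots> = expected_weight E w p k alg"
    using expected_weight_eq[OF finite_E p alg_strategy] by simp
  finally show ?thesis .
qed

end

theorem theorem12:
  fixes V :: "'v set" and E :: "'v set set"
    and w p :: "'v set \<Rightarrow> real" and t :: "'v \<Rightarrow> nat" and k C :: nat
    and x y :: "nat \<Rightarrow> 'v set \<Rightarrow> real"
    and m :: "nat \<Rightarrow> nat" and lam :: "nat \<Rightarrow> nat \<Rightarrow> real" and M :: "nat \<Rightarrow> nat \<Rightarrow> 'v set set"
  assumes "simple_graph V E"
    and "\<And>e. e \<in> E \<Longrightarrow> w e \<ge> 0"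
    and "\<And>e. e \<in> E \<Longrightarrow> 0 \<le> p e \<and> p e \<le> 1"
    and "\<And>i. i \<in> V \<Longrightarrow> t i \<ge> 1"
    and "k \<ge> 1" and "C \<ge> 1"
    and "lp_optimal V E w p t k C x y"
    and "\<And>h l. h \<in> {1..k} \<Longrightarrow> l \<in> {1..m h} \<Longrightarrow> lam h l > 0 \<and> M h l \<in> matchings E C"
    and "\<And>h. h \<in> {1..k} \<Longrightarrow> (\<Sum>l=1..m h. lam h l) = 1"
    and "\<And>h e. h \<in> {1..k} \<Longrightarrow> e \<in> E \<Longrightarrow> y h e = (\<Sum>l=1..m h. lam h l * indicator (M h l) e)"
  shows "approximation 20 E w p t k C (lp_algorithm E t 10 m lam M)"
proof -
  interpret lp_rounding V E p t k C x y m lam M 10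
  proof unfold_locales
    show "lp_feasible V E p t k C x y"
      using assms(7) unfolding lp_optimal_def by (rule conjunct1)
  qed (fact assms(1) assms(3) assms(4) assms(8) assms(9) assms(10) | simp)+
  have "opt E w p t k C \<le> lp_objective E w k x"
    using opt_le_lp_objective[OF finite_E assms(3,7)] .
  \<comment> \<open>At \<open>\<alpha> = 10\<close> the factor is (1 - 1/2) / 10 = 1/20.\<close>
  then have "1 / 20 * opt E w p t k C \<le> expected_weight E w p k alg"
    using expected_weight_alg_ge[of w] assms(2) by simp
  then show ?thesis
    using alg_strategy by (simp add: approximation_def)
qed

end
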